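(* Consider the one-component two-dimensional sinusoidal model $$y(t,s) = A^0\cos(\lambda^0 t+\mu^0 s)+B^0\sin(\lambda^0 t+\mu^0 s)+\epsilon(t,s),\qquad t\in\{1,\dots,T\},\ s\in\{1,\dots,S\},$$ with true parameter $\theta_0=(A^0,B^0,\lambda^0,\mu^0)$. Assume: (1) The parameter space is $\Theta=K\times K\times[0,\pi]\times[0,\pi]$, where $K$ is a compact subset of $\mathbb{R}$, and $\theta_0$ is an interior point of $\Theta$. (2) The $\epsilon(t,s)$ are independent and identically distributed random variables with common distribution function $G$ and continuous probability density function $g$, such that $G$ has unique median at $0$, i.e. $G(0)=\tfrac12$; the derivative $g'$ exists and is bounded; and $\mathbb{E}[\epsilon(t,s)^2]<\infty$ for all $t,s$. Let $\hat\theta_{T,S}$ be the least absolute deviation (LAD) estimator of $\theta_0$. Then $\hat\theta_{T,S}$ is strongly consistent for $\theta_0$, i.e. $$\hat\theta_{T,S}\xrightarrow{\text{a.s.}}\theta_0\qquad\text{as }\min\{T,S\}\to\infty.$$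
   Context: The LAD estimator $\hat\theta_{T,S}=(\hat A_{T,S},\hat B_{T,S},\hat\lambda_{T,S},\hat\mu_{T,S})$ is obtained by minimizing, over $\theta=(A,B,\lambda,\mu)\in\Theta$, the objective function $$Q_{T,S}(\theta)=\frac{1}{TS}\sum_{t=1}^{T}\sum_{s=1}^{S}\Big|y(t,s)-A\cos(\lambda t+\mu s)-B\sin(\lambda t+\mu s)\Big|,$$ i.e. $\hat\theta_{T,S}=\arg\min_{\theta\in\Theta}Q_{T,S}(\theta)$.
   Formalization: The formal theorem additionally assumes (A^0,B^0) ≠ (0,0); without this, when A^0=B^0=0 the data do not depend on (λ^0,μ^0), so the same estimator would have to converge to different limits and the claim fails. *)

theory Defs
  imports "HOL-Probability.Probability"
begin

text \<open>A parameter is a tuple \<open>(A, B, \<lambda>, \<mu>)\<close>.\<close>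

type_synonym param = "real \<times> real \<times> real \<times> real"

definition param_space :: "real set \<Rightarrow> param set" where
  "param_space K = K \<times> K \<times> {0..pi} \<times> {0..pi}"

fun sinusoid :: "param \<Rightarrow> nat \<Rightarrow> nat \<Rightarrow> real" where
  "sinusoid (A, B, l, m) t s =
     A * cos (l * real t + m * real s) + B * sin (l * real t + m * real s)"

definition lad_objective :: "(nat \<Rightarrow> nat \<Rightarrow> real) \<Rightarrow> nat \<Rightarrow> nat \<Rightarrow> param \<Rightarrow> real" where
  "lad_objective y T S \<theta> =
     1 / (real T * real S) * (\<Sum>t = 1..T. \<Sum>s = 1..S. \<bar>y t s - sinusoid \<theta> t s\<bar>)"

text \<open>Minimizers need not be unique, so being a LAD estimate is a predicate on parameters.\<close>

definition is_lad_estimate ::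
  "param set \<Rightarrow> (nat \<Rightarrow> nat \<Rightarrow> real) \<Rightarrow> nat \<Rightarrow> nat \<Rightarrow> param \<Rightarrow> bool" where
  "is_lad_estimate \<Theta> y T S \<theta> \<longleftrightarrow>
     is_arg_min (lad_objective y T S) (\<lambda>\<theta>'. \<theta>' \<in> \<Theta>) \<theta>"

end

theory Submission
  imports Defs "HOL-Real_Asymp.Real_Asymp"
begin

text \<open>
  Put \<open>\<phi>(h) = E(\<bar>\<epsilon> + h\<bar> - \<bar>\<epsilon>\<bar>)\<close>. This function is convex, vanishes at \<open>0\<close> and, the median being unique, is
  positive elsewhere, so it dominates \<open>c (\<bar>h\<bar> - \<eta>)\<close> for every \<open>\<eta> > 0\<close> and some \<open>c > 0\<close>. With \<open>h\<^sub>\<theta>(t,s)\<close> the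
  difference of the true signal and the signal at \<open>\<theta>\<close>, the excess of the objective at \<open>\<theta>\<close> over its value
  at the true parameter is the average of \<open>\<bar>\<epsilon> + h\<^sub>\<theta>\<bar> - \<bar>\<epsilon>\<bar>\<close>. Hoeffding's inequality bounds its deviation from the average
  of \<open>\<phi>(h\<^sub>\<theta>)\<close> with probability exponentially small in \<open>n = T S\<close>. A parameter grid of mesh of order \<open>1/n\<close> has only
  \<open>O(n\<^sup>4)\<close> points and approximates all signals uniformly on the rectangle; as there are at most \<open>n\<^sup>2\<close> rectangles of
  area \<open>n\<close>, Borel--Cantelli gives the bound uniformly in \<open>\<theta>\<close>, almost surely for all rectangles of large area.

  It remains to bound the average of \<open>h\<^sub>\<theta>\<^sup>2\<close> below for \<open>\<theta>\<close> away from the truth. If \<open>T \<bar>\<lambda> - \<lambda>\<^sup>0\<bar>\<close> or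
  \<open>S \<bar>\<mu> - \<mu>\<^sup>0\<bar>\<close> is large, the two signals are almost orthogonal, by the geometric sum formula, and the true signal
  alone provides the bound. Otherwise the phases almost agree on a corner of the rectangle of proportional size, where
  the distance of the amplitudes provides it.
\<close>

section \<open>Trigonometric sums\<close>

lemma abs_sin_half_ge:
  assumes "\<bar>x\<bar> \<le> pi"
  shows "\<bar>x\<bar> / pi \<le> \<bar>sin (x / 2)\<bar>"
proof -
  define u where "u = \<bar>x\<bar> / pi"
  have u: "0 \<le> u" "u \<le> 1" using assms by (auto simp: u_def)
  \<comment> \<open>Sine is concave on \<open>{0..pi/2}\<close>, so its graph lies above the chord
    from the origin to height 1 at \<open>pi/2\<close>; \<open>u\<close> is the position along this
    chord.\<close>
  have "convex_on {0..pi/2} (\<lambda>x. - sin x)"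
    by (rule f''_ge0_imp_convex[where f' = "\<lambda>x. - cos x" and f'' = sin])
       (auto intro!: derivative_eq_intros sin_ge_zero)
  then have "- sin ((1 - u) *\<^sub>R 0 + u *\<^sub>R (pi/2)) \<le> (1 - u) * - sin 0 + u * - sin (pi/2)"
    using u by (intro convex_onD) auto
  then have "u \<le> sin (\<bar>x\<bar> / 2)" by (simp add: u_def)
  also have "\<dots> \<le> \<bar>sin (x / 2)\<bar>" by (cases "x \<ge> 0") auto
  finally show ?thesis by (simp add: u_def)
qed

text \<open>Multiplying by \<open>cis x - 1\<close>, whose modulus is
  \<open>2 * \<bar>sin (x / 2)\<bar>\<close>, makes the sum telescope to a difference of two unit
  numbers.\<close>

lemma norm_sum_cis_le:
  assumes "sin (x / 2) \<noteq> 0"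
  shows "norm (\<Sum>t=1..n. cis (x * real t)) \<le> 1 / \<bar>sin (x / 2)\<bar>"
proof -
  have "(cis x - 1) * (\<Sum>t=1..n. cis (x * real t)) = cis (x * real (Suc n)) - cis x"
    by (induction n) (auto simp: algebra_simps cis_mult)
  then have "norm (cis x - 1) * norm (\<Sum>t=1..n. cis (x * real t)) = norm (cis (x * real (Suc n)) - cis x)"
    by (metis norm_mult)
  also have "\<dots> \<le> 2" using norm_triangle_ineq4[of "cis (x * real (Suc n))" "cis x"] by simp
  finally have "2 * \<bar>sin (x / 2)\<bar> * norm (\<Sum>t=1..n. cis (x * real t)) \<le> 2"
    using dist_exp_i_1[of x] by (simp add: cis_conv_exp)
  then show ?thesis using assms by (simp add: field_simps)
qed

text \<open>Cosine and sine sums are packed into one complex sum because it splits into a product of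
  two one-dimensional geometric sums.\<close>

definition cis_sum :: "nat \<Rightarrow> nat \<Rightarrow> real \<Rightarrow> real \<Rightarrow> complex" where
  "cis_sum T S x y = (\<Sum>t=1..T. \<Sum>s=1..S. cis (x * real t + y * real s))"

lemma cis_sum_factor:
  "cis_sum T S x y = (\<Sum>t=1..T. cis (x * real t)) * (\<Sum>s=1..S. cis (y * real s))"
  by (simp add: cis_sum_def sum_product cis_mult)

lemma norm_sum_cis_trivial: "norm (\<Sum>t=1..n. cis (x * real t)) \<le> real n"
  using norm_sum[of "\<lambda>t. cis (x * real t)" "{1..n}"] by simp

text \<open>One factor is bounded by the geometric sum formula, the other trivially by
  \<open>S\<close>. Compared with the trivial bound \<open>T * S\<close>, this gains a factor of
  order \<open>T\<close>.\<close>

lemma norm_cis_sum_le: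
  assumes "c > 0" "c \<le> \<bar>sin (x / 2)\<bar>"
  shows "norm (cis_sum T S x y) \<le> real S / c"
proof -
  have "norm (\<Sum>t=1..T. cis (x * real t)) \<le> 1 / \<bar>sin (x / 2)\<bar>"
    using assms by (intro norm_sum_cis_le) auto
  also have "\<dots> \<le> 1 / c" using assms by (intro divide_left_mono) auto
  finally have "norm (cis_sum T S x y) \<le> 1 / c * real S"
    unfolding cis_sum_factor norm_mult using assms
    by (intro mult_mono norm_sum_cis_trivial) auto
  then show ?thesis by simp
qed

lemma cis_sum_swap: "cis_sum T S x y = cis_sum S T y x"
  by (simp add: cis_sum_factor mult.commute)

section \<open>Sums of sinusoids, of their products and of their squares\<close>

lemma abs_sum_sinusoid_le:
  "\<bar>\<Sum>t=1..T. \<Sum>s=1..S. sinusoid (a, b, x, y) t s\<bar> \<le> (\<bar>a\<bar> + \<bar>b\<bar>) * norm (cis_sum T S x y)"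
proof -
  have "(\<Sum>t=1..T. \<Sum>s=1..S. sinusoid (a, b, x, y) t s) =
      a * Re (cis_sum T S x y) + b * Im (cis_sum T S x y)"
    by (simp add: cis_sum_def sum.distrib sum_distrib_left)
  also have "\<bar>\<dots>\<bar> \<le> \<bar>a\<bar> * norm (cis_sum T S x y) + \<bar>b\<bar> * norm (cis_sum T S x y)"
    by (intro order_trans[OF abs_triangle_ineq] add_mono)
       (auto simp: abs_mult intro!: mult_left_mono abs_Re_le_cmod abs_Im_le_cmod)
  finally show ?thesis by (simp add: algebra_simps)
qed

text \<open>The product-to-sum formulas keep the sinusoidal form, at the sum and the difference of
  the frequencies, so the estimate for plain sums also handles squares and cross terms.\<close>

lemma sinusoid_mult:
  "sinusoid (a, b, x, y) t s * sinusoid (a', b', x', y') t s =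
     sinusoid ((a * a' - b * b') / 2, (a * b' + b * a') / 2, x + x', y + y') t s +
     sinusoid ((a * a' + b * b') / 2, (b * a' - a * b') / 2, x - x', y - y') t s"
proof -
  define p q where "p = x * real t + y * real s" and "q = x' * real t + y' * real s"
  have e: "(x + x') * real t + (y + y') * real s = p + q"
          "(x - x') * real t + (y - y') * real s = p - q"
    by (simp_all add: p_def q_def algebra_simps)
  show ?thesis
    unfolding sinusoid.simps e p_def[symmetric] q_def[symmetric]
    by (simp add: cos_add cos_diff sin_add sin_diff field_simps)
qed

text \<open>The difference frequency of a square is zero, which yields the constant main term. The
  doubled frequency \<open>2 * x\<close> contributes an oscillating sum, and the geometric bound for
  it involves \<open>sin x\<close>.\<close>

lemma sum_sinusoid_square_ge:
  assumes "0 < x" "x < pi"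
  shows "(a\<^sup>2 + b\<^sup>2) / 2 * (real T * real S) - (a\<^sup>2 + b\<^sup>2) * real S / sin x
    \<le> (\<Sum>t=1..T. \<Sum>s=1..S. (sinusoid (a, b, x, y) t s)\<^sup>2)"
proof -
  have "(\<Sum>t=1..T. \<Sum>s=1..S. (sinusoid (a, b, x, y) t s)\<^sup>2) =
     (\<Sum>t=1..T. \<Sum>s=1..S. sinusoid ((a\<^sup>2 - b\<^sup>2) / 2, a * b, 2 * x, 2 * y) t s) +
     (a\<^sup>2 + b\<^sup>2) / 2 * (real T * real S)"
    unfolding power2_eq_square[of "sinusoid _ _ _"] sinusoid_mult
    by (simp add: sum.distrib power2_eq_square algebra_simps)
  moreover have "\<bar>\<Sum>t=1..T. \<Sum>s=1..S. sinusoid ((a\<^sup>2 - b\<^sup>2) / 2, a * b, 2 * x, 2 * y) t s\<bar>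
      \<le> (a\<^sup>2 + b\<^sup>2) * (real S / sin x)"
  proof (rule order_trans[OF abs_sum_sinusoid_le], intro mult_mono)
    have "\<bar>(a\<^sup>2 - b\<^sup>2) / 2\<bar> \<le> (a\<^sup>2 + b\<^sup>2) / 2" by (auto simp: abs_le_iff)
    moreover have "0 \<le> (\<bar>a\<bar> - \<bar>b\<bar>)\<^sup>2" by simp
    then have "\<bar>a * b\<bar> \<le> (a\<^sup>2 + b\<^sup>2) / 2" 
      by (simp add: power2_diff abs_mult)
    ultimately show "\<bar>(a\<^sup>2 - b\<^sup>2) / 2\<bar> + \<bar>a * b\<bar> \<le> a\<^sup>2 + b\<^sup>2"
      using field_sum_of_halves[of "a\<^sup>2 + b\<^sup>2"] by (metis add_mono)
    show "norm (cis_sum T S (2 * x) (2 * y)) \<le> real S / sin x"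
      using assms sin_gt_zero[of x] by (intro norm_cis_sum_le) auto
  qed auto
  ultimately show ?thesis unfolding times_divide_eq_right by linarith
qed

lemma abs_sum_sinusoid_mult_le:
  assumes bd: "\<bar>a\<bar> \<le> R" "\<bar>b\<bar> \<le> R" "\<bar>a'\<bar> \<le> R" "\<bar>b'\<bar> \<le> R"
  shows "\<bar>\<Sum>t=1..T. \<Sum>s=1..S. sinusoid (a, b, x, y) t s * sinusoid (a', b', x', y') t s\<bar>
    \<le> 2 * R\<^sup>2 * norm (cis_sum T S (x + x') (y + y')) + 2 * R\<^sup>2 * norm (cis_sum T S (x - x') (y - y'))"
proof -
  have R: "\<bar>p * q\<bar> \<le> R\<^sup>2" if "\<bar>p\<bar> \<le> R" "\<bar>q\<bar> \<le> R" for p q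
    using that by (auto simp: abs_mult power2_eq_square intro!: mult_mono)
  have half: "\<bar>(p - q) / 2\<bar> \<le> k" "\<bar>(p + q) / 2\<bar> \<le> k" if "\<bar>p\<bar> \<le> k" "\<bar>q\<bar> \<le> k" for p q k :: real
    using that by (auto simp: abs_le_iff)
  have "\<bar>(a * a' - b * b') / 2\<bar> + \<bar>(a * b' + b * a') / 2\<bar> \<le> 2 * R\<^sup>2"
       "\<bar>(a * a' + b * b') / 2\<bar> + \<bar>(b * a' - a * b') / 2\<bar> \<le> 2 * R\<^sup>2"
    unfolding mult_2 by (intro add_mono half R bd)+
  then show ?thesis
    unfolding sinusoid_mult sum.distrib
    by (intro order_trans[OF abs_triangle_ineq] add_mono order_trans[OF abs_sum_sinusoid_le] mult_right_mono) auto
qed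

section \<open>Size of a sinusoid and its dependence on the parameter\<close>

lemma abs_sinusoid_le:
  assumes "\<bar>a\<bar> \<le> R" "\<bar>b\<bar> \<le> R"
  shows "\<bar>sinusoid (a, b, x, y) t s\<bar> \<le> 2 * R"
proof -
  have "\<bar>sinusoid (a, b, x, y) t s\<bar> \<le> \<bar>a\<bar> * 1 + \<bar>b\<bar> * 1"
    unfolding sinusoid.simps
    by (intro order_trans[OF abs_triangle_ineq] add_mono) (auto simp: abs_mult intro!: mult_left_le)
  then show ?thesis using assms by linarith
qed

text \<open>First the amplitudes change at the phase \<open>p\<close>, then the phase moves to
  \<open>q\<close> with the bounded amplitudes \<open>a'\<close> and \<open>b'\<close>; cosine and
  sine are 1-Lipschitz.\<close>

lemma abs_sinusoid_diff_le:
  assumes "\<bar>a'\<bar> \<le> R" "\<bar>b'\<bar> \<le> R"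
  shows "\<bar>sinusoid (a, b, x, y) t s - sinusoid (a', b', x', y') t s\<bar>
    \<le> \<bar>a - a'\<bar> + \<bar>b - b'\<bar> + 2 * R * (\<bar>x - x'\<bar> * real t + \<bar>y - y'\<bar> * real s)"
proof -
  define p q where "p = x * real t + y * real s" and "q = x' * real t + y' * real s"
  define d where "d = \<bar>x - x'\<bar> * real t + \<bar>y - y'\<bar> * real s"
  have lip: "\<bar>cos p - cos q\<bar> \<le> \<bar>p - q\<bar>" "\<bar>sin p - sin q\<bar> \<le> \<bar>p - q\<bar>"
  proof -
    have *: "\<bar>2 * u * sin ((p - q) / 2)\<bar> \<le> \<bar>p - q\<bar>" if "\<bar>u\<bar> \<le> 1" for u
    proof -
      have "\<bar>u\<bar> * \<bar>sin ((p - q) / 2)\<bar> \<le> 1 * \<bar>(p - q) / 2\<bar>"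
        using that by (intro mult_mono abs_sin_x_le_abs_x) auto
      then show ?thesis by (simp add: abs_mult)
    qed
    show "\<bar>sin p - sin q\<bar> \<le> \<bar>p - q\<bar>"
      using *[of "cos ((p + q) / 2)"] by (simp add: sin_diff_sin mult_ac)
    have "cos p - cos q = - (2 * sin ((p + q) / 2) * sin ((p - q) / 2))"
      using cos_diff_cos[of p q] by (metis minus_diff_eq minus_divide_left mult_minus_right sin_minus)
    then show "\<bar>cos p - cos q\<bar> \<le> \<bar>p - q\<bar>"
      using *[of "sin ((p + q) / 2)"] by simp
  qed
  have "p - q = (x - x') * real t + (y - y') * real s" by (simp add: p_def q_def algebra_simps)
  then have "\<bar>p - q\<bar> \<le> d"
    unfolding d_def using abs_triangle_ineq[of "(x - x') * real t" "(y - y') * real s"] by (simp add: abs_mult)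
  then have lip': "\<bar>cos p - cos q\<bar> \<le> d" "\<bar>sin p - sin q\<bar> \<le> d" using lip by auto
  have "sinusoid (a, b, x, y) t s - sinusoid (a', b', x', y') t s =
      (a - a') * cos p + (b - b') * sin p + a' * (cos p - cos q) + b' * (sin p - sin q)"
    by (simp add: p_def q_def algebra_simps)
  also have "\<bar>\<dots>\<bar> \<le> \<bar>a - a'\<bar> * 1 + \<bar>b - b'\<bar> * 1 + R * d + R * d"
    using assms lip'
    by (intro order_trans[OF abs_triangle_ineq] add_mono) (auto simp: abs_mult intro!: mult_mono mult_left_le)
  finally show ?thesis by (simp add: d_def)
qed

section \<open>Identifiability\<close>

text \<open>The square of the difference is expanded and the candidate's own square discarded. The
  true signal gives the main term. The cross term lives at the sum frequencies, controlled by
  \<open>c\<close>, and at the difference frequencies, controlled by \<open>far\<close>.\<close>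

lemma sum_square_diff_ge_far_frequencies:
  assumes l0: "0 < l0" "l0 < pi" and l: "0 \<le> l" "l \<le> pi" and m: "\<bar>m0 - m\<bar> \<le> pi"
    and bd: "\<bar>A0\<bar> \<le> R" "\<bar>B0\<bar> \<le> R" "\<bar>A\<bar> \<le> R" "\<bar>B\<bar> \<le> R"
    and "L > 0" "T > 0" "S > 0"
    and far: "L \<le> real T * \<bar>l0 - l\<bar> \<or> L \<le> real S * \<bar>m0 - m\<bar>"
  defines "c \<equiv> min (sin (l0 / 2)) (cos (l0 / 2))"
  shows "(real T * real S) * ((A0\<^sup>2 + B0\<^sup>2) / 2 - (A0\<^sup>2 + B0\<^sup>2) / sin l0 / T - 4 * R\<^sup>2 / c / T - 4 * R\<^sup>2 * (pi / L))
    \<le> (\<Sum>t=1..T. \<Sum>s=1..S. (sinusoid (A0, B0, l0, m0) t s - sinusoid (A, B, l, m) t s)\<^sup>2)"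
proof -
  have sin0: "sin (l0 / 2) > 0" "cos (l0 / 2) > 0"
    using l0 by (auto intro!: sin_gt_zero cos_gt_zero)
  then have c: "c > 0" by (auto simp: c_def)
  \<comment> \<open>The angle \<open>(l0 + l) / 2\<close> runs through the interval from
    \<open>l0 / 2\<close> to \<open>l0 / 2 + pi / 2\<close>. Sine is smallest there at an endpoint,
    where it equals \<open>sin (l0 / 2)\<close> or \<open>cos (l0 / 2)\<close>.\<close>
  have "sin (l0 / 2) \<le> sin ((l0 + l) / 2) \<or> cos (l0 / 2) \<le> sin ((l0 + l) / 2)"
  proof (cases "l0 + l \<le> pi")
    case True
    then have "sin (l0 / 2) \<le> sin ((l0 + l) / 2)"
      using l0 l by (intro sin_monotone_2pi_le) auto
    then show ?thesis ..
  next
    case False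
    have "sin (pi / 2 - l0 / 2) \<le> sin (pi - (l0 + l) / 2)"
      using False l0 l by (intro sin_monotone_2pi_le) (auto simp: field_simps)
    also have "sin (pi - (l0 + l) / 2) = sin ((l0 + l) / 2)" by (simp only: sin_pi_minus)
    also have "sin (pi / 2 - l0 / 2) = cos (l0 / 2)" by (simp add: sin_diff)
    finally show ?thesis ..
  qed
  then have plus: "norm (cis_sum T S (l0 + l) (m0 + m)) \<le> real S / c"
    using c by (intro norm_cis_sum_le) (auto simp: c_def)
  \<comment> \<open>\<open>T\<close> and \<open>S\<close> are quantified afresh so that the bound
    also applies with the two coordinates exchanged.\<close>
  have aux: "norm (cis_sum T S x y) \<le> (real T * real S) * (pi / L)"
    if "L \<le> real T * \<bar>x\<bar>" "\<bar>x\<bar> \<le> pi" "T > 0" for x y T S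
  proof -
    have "L / (real T * pi) \<le> \<bar>x\<bar> / pi" using that by (simp add: field_simps)
    also have "\<dots> \<le> \<bar>sin (x / 2)\<bar>" by (rule abs_sin_half_ge) fact
    finally have "norm (cis_sum T S x y) \<le> real S / (L / (real T * pi))"
      using that \<open>L > 0\<close> by (intro norm_cis_sum_le) auto
    then show ?thesis by (simp add: mult_ac)
  qed
  have minus: "norm (cis_sum T S (l0 - l) (m0 - m)) \<le> (real T * real S) * (pi / L)"
    using far
  proof
    assume "L \<le> real T * \<bar>l0 - l\<bar>"
    then show ?thesis using l l0 \<open>T > 0\<close> by (intro aux) auto
  next
    assume "L \<le> real S * \<bar>m0 - m\<bar>"
    then have "norm (cis_sum S T (m0 - m) (l0 - l)) \<le> (real S * real T) * (pi / L)"
      using m \<open>S > 0\<close> by (intro aux) auto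
    then show ?thesis by (subst cis_sum_swap) (simp add: mult_ac)
  qed
  let ?z = "sinusoid (A0, B0, l0, m0)" and ?x = "sinusoid (A, B, l, m)"
  have "(\<Sum>t=1..T. \<Sum>s=1..S. ?z t s * ?x t s) \<le>
      2 * R\<^sup>2 * norm (cis_sum T S (l0 + l) (m0 + m)) + 2 * R\<^sup>2 * norm (cis_sum T S (l0 - l) (m0 - m))"
    using abs_sum_sinusoid_mult_le[OF bd, of l0 m0 l m S T] by linarith
  also have "\<dots> \<le> 2 * R\<^sup>2 * (real S / c) + 2 * R\<^sup>2 * ((real T * real S) * (pi / L))"
    using plus minus by (intro add_mono mult_left_mono) auto
  finally have cross: "(\<Sum>t=1..T. \<Sum>s=1..S. ?z t s * ?x t s) \<le> \<dots>" .
  have alg: "(real T * real S) * (p / 2 - p / u / T - r / c / T - w) =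
      p / 2 * (real T * real S) - p * real S / u - r * (real S / c) - real T * real S * w" for p u r w
    using \<open>T > 0\<close> by (simp add: right_diff_distrib mult_ac)
  have "(real T * real S) * ((A0\<^sup>2 + B0\<^sup>2) / 2 - (A0\<^sup>2 + B0\<^sup>2) / sin l0 / T - 4 * R\<^sup>2 / c / T - 4 * R\<^sup>2 * (pi / L))
     = ((A0\<^sup>2 + B0\<^sup>2) / 2 * (real T * real S) - (A0\<^sup>2 + B0\<^sup>2) * real S / sin l0)
      - 2 * (2 * R\<^sup>2 * (real S / c) + 2 * R\<^sup>2 * ((real T * real S) * (pi / L)))"
    unfolding alg by (simp add: algebra_simps)
  also have "\<dots> \<le> (\<Sum>t=1..T. \<Sum>s=1..S. (?z t s)\<^sup>2) - 2 * (\<Sum>t=1..T. \<Sum>s=1..S. ?z t s * ?x t s)"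
    using cross by (intro diff_mono mult_left_mono sum_sinusoid_square_ge l0) auto
  also have "\<dots> = (\<Sum>t=1..T. \<Sum>s=1..S. (?z t s)\<^sup>2 - 2 * (?z t s * ?x t s))"
    by (simp add: sum_subtractf sum_distrib_left del: sinusoid.simps)
  also have "\<dots> \<le> (\<Sum>t=1..T. \<Sum>s=1..S. (?z t s - ?x t s)\<^sup>2)"
    by (intro sum_mono) (simp add: power2_diff del: sinusoid.simps)
  finally show ?thesis .
qed

text \<open>At the true frequencies the difference would be the sinusoid \<open>?v\<close> of the
  amplitude differences. Moving the frequencies shifts every phase in the rectangle by at most
  \<open>2 * d\<close>, an error of at most \<open>4 * R * d\<close>.\<close>

lemma sum_square_diff_ge_near_frequencies:
  fixes A0 B0 :: real
  assumes l0: "0 < l0" "l0 < pi"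
    and bd: "\<bar>A\<bar> \<le> R" "\<bar>B\<bar> \<le> R"
    and near: "real T * \<bar>l0 - l\<bar> \<le> d" "real S * \<bar>m0 - m\<bar> \<le> d"
  defines "q \<equiv> (A0 - A)\<^sup>2 + (B0 - B)\<^sup>2"
  shows "q / 4 * (real T * real S) - q * real S / sin l0 / 2 - (real T * real S) * (4 * R * d)\<^sup>2
    \<le> (\<Sum>t=1..T. \<Sum>s=1..S. (sinusoid (A0, B0, l0, m0) t s - sinusoid (A, B, l, m) t s)\<^sup>2)"
proof -
  let ?z = "sinusoid (A0, B0, l0, m0)" and ?x = "sinusoid (A, B, l, m)" and ?v = "sinusoid (A0 - A, B0 - B, l0, m0)"
  have R: "R \<ge> 0" using bd by linarith
  have pt: "(?v t s)\<^sup>2 / 2 - (4 * R * d)\<^sup>2 \<le> (?z t s - ?x t s)\<^sup>2"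
    if "t \<in> {1..T}" "s \<in> {1..S}" for t s
  proof -
    define v where "v = ?v t s"
    define e where "e = sinusoid (A, B, l0, m0) t s - ?x t s"
    have "\<bar>l0 - l\<bar> * real t \<le> real T * \<bar>l0 - l\<bar>" "\<bar>m0 - m\<bar> * real s \<le> real S * \<bar>m0 - m\<bar>"
      using that by (auto simp: mult.commute intro!: mult_right_mono)
    then have "\<bar>l0 - l\<bar> * real t + \<bar>m0 - m\<bar> * real s \<le> 2 * d" using near by linarith
    then have "2 * R * (\<bar>l0 - l\<bar> * real t + \<bar>m0 - m\<bar> * real s) \<le> 2 * R * (2 * d)"
      using R by (intro mult_left_mono) auto
    then have "\<bar>e\<bar> \<le> 4 * R * d"
      using abs_sinusoid_diff_le[OF bd, of A B l0 m0 t s l m] unfolding e_def by linarith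
    then have e: "e\<^sup>2 \<le> (4 * R * d)\<^sup>2" by (metis abs_ge_zero power2_abs power_mono)
    have eq: "?z t s - ?x t s = v + e" by (simp add: e_def v_def algebra_simps)
    \<comment> \<open>Expanding and halving this square absorbs the mixed term
      \<open>2 * v * e\<close>, at the cost of half of the square of \<open>v\<close>.\<close>
    have "0 \<le> (v + 2 * e)\<^sup>2" by simp
    then have "v\<^sup>2 / 2 - e\<^sup>2 \<le> (v + e)\<^sup>2" by (simp add: power2_sum power_mult_distrib)
    then show ?thesis unfolding eq using e unfolding v_def by linarith
  qed
  have "q / 4 * (real T * real S) - q * real S / sin l0 / 2 - (real T * real S) * (4 * R * d)\<^sup>2
     = (q / 2 * (real T * real S) - q * real S / sin l0) / 2 - (real T * real S) * (4 * R * d)\<^sup>2"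
    by (simp add: algebra_simps)
  also have "\<dots> \<le> (\<Sum>t=1..T. \<Sum>s=1..S. (?v t s)\<^sup>2) / 2 - (real T * real S) * (4 * R * d)\<^sup>2"
    unfolding q_def by (intro diff_right_mono divide_right_mono sum_sinusoid_square_ge l0) auto
  also have "\<dots> = (\<Sum>t=1..T. \<Sum>s=1..S. (?v t s)\<^sup>2 / 2 - (4 * R * d)\<^sup>2)"
    by (simp add: sum_subtractf sum_divide_distrib del: sinusoid.simps)
  also have "\<dots> \<le> (\<Sum>t=1..T. \<Sum>s=1..S. (?z t s - ?x t s)\<^sup>2)"
    by (intro sum_mono pt)
  finally show ?thesis .
qed

lemma dist_Pair_le: "dist (a, b) (c, d) \<le> dist a c + dist b d"
  by (simp add: dist_Pair_Pair sqrt_sum_squares_le_sum)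

lemma real_div_ge:
  assumes "real k > 0"
  shows "real n / real k - 1 \<le> real (n div k)"
proof -
  have "real n = real k * real (n div k) + real (n mod k)"
    by (metis mult_div_mod_eq of_nat_add of_nat_mult)
  moreover have "real (n mod k) \<le> real k" using assms by (simp add: less_imp_le)
  ultimately show ?thesis using assms by (simp add: field_simps)
qed

text \<open>
  If the frequencies match to order \<open>1/T\<close> and \<open>1/S\<close>, the phases need not agree on the whole rectangle,
  but they almost agree on its corner of size \<open>T div k\<close> by \<open>S div k\<close>, where the amplitudes are compared.
\<close>

lemma sinusoid_separation:
  assumes l0: "0 < l0" "l0 < pi" and m0: "0 < m0" "m0 < pi"
    and nz: "(A0, B0) \<noteq> (0, 0)" and bd0: "\<bar>A0\<bar> \<le> R" "\<bar>B0\<bar> \<le> R" and \<delta>: "\<delta> > 0"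
  obtains \<kappa> N where "\<kappa> > 0"
    "\<And>T S A B l m. N \<le> T \<Longrightarrow> N \<le> S \<Longrightarrow> \<bar>A\<bar> \<le> R \<Longrightarrow> \<bar>B\<bar> \<le> R \<Longrightarrow> l \<in> {0..pi} \<Longrightarrow> m \<in> {0..pi} \<Longrightarrow>
       \<delta> \<le> dist (A, B, l, m) (A0, B0, l0, m0) \<Longrightarrow>
       \<kappa> * (real T * real S) \<le>
         (\<Sum>t=1..T. \<Sum>s=1..S. (sinusoid (A0, B0, l0, m0) t s - sinusoid (A, B, l, m) t s)\<^sup>2)"
proof -
  define \<rho> where "\<rho> = A0\<^sup>2 + B0\<^sup>2"
  define c where "c = min (sin (l0 / 2)) (cos (l0 / 2))"
  have \<rho>: "\<rho> > 0" using nz by (auto simp: \<rho>_def sum_power2_gt_zero_iff)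
  have R: "R > 0" using nz bd0 by auto
  have c: "c > 0" using l0 by (auto simp: c_def intro!: sin_gt_zero cos_gt_zero)
  have sin: "sin l0 > 0" using l0 by (intro sin_gt_zero)
  \<comment> \<open>Chosen so that the loss from the difference frequencies in the far case,
    \<open>4 * R\<^sup>2 * (pi / L)\<close>, is exactly \<open>\<rho> / 8\<close>.\<close>
  define L where "L = 32 * R\<^sup>2 * pi / \<rho>"
  have L: "L > 0" using R \<rho> by (simp add: L_def)
  \<comment> \<open>Shrinking the sides by \<open>k\<close> reduces the phase error to
    \<open>d = L / k\<close>, and this choice makes \<open>4 * R * d\<close> at most
    \<open>\<delta> / 16\<close>.\<close>
  obtain k :: nat where k: "64 * R * L / \<delta> < real k" using reals_Archimedean2 by blast
  have k0: "real k > 0" using k R L \<delta> by (smt (verit) divide_pos_pos mult_pos_pos)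
  \<comment> \<open>\<open>N1\<close> and \<open>N2\<close> make each error term of order
    \<open>1/T\<close> in the far case at most \<open>\<rho> / 16\<close>. \<open>N3\<close> turns a
    near frequency into one within \<open>\<delta> / 4\<close>. \<open>N4\<close> makes the corner
    long enough for its oscillating term to be at most \<open>q / 8\<close>.\<close>
  define N1 N2 N3 N4 where "N1 = 16 / sin l0" and "N2 = 64 * R\<^sup>2 / (c * \<rho>)" and "N3 = 4 * L / \<delta>"
    and "N4 = k * (4 / sin l0 + 1)"
  have pos: "N1 > 0" "N2 > 0" "N3 > 0" "N4 > 0"
    using sin R c \<rho> L \<delta> k0 by (auto simp: N1_def N2_def N3_def N4_def intro!: mult_pos_pos add_pos_pos)
  obtain N :: nat where N: "N1 + N2 + N3 + N4 + 2 * real k < real N" using reals_Archimedean2 by blast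
  \<comment> \<open>The far case leaves \<open>\<rho> / 4\<close>. The near case leaves
    \<open>\<delta>\<^sup>2 / 128\<close> on a corner occupying at least the fraction
    \<open>1 / (4 * k\<^sup>2)\<close> of the rectangle.\<close>
  define \<kappa> where "\<kappa> = min (\<rho> / 4) (\<delta>\<^sup>2 / (512 * (real k)\<^sup>2))"
  have "\<kappa> > 0" using \<rho> \<delta> k0 by (auto simp: \<kappa>_def)
  then show thesis
  proof (rule that)
    fix T S :: nat and A B l m :: real
    assume TS: "N \<le> T" "N \<le> S" and bd: "\<bar>A\<bar> \<le> R" "\<bar>B\<bar> \<le> R"
      and lm: "l \<in> {0..pi}" "m \<in> {0..pi}" and dist: "\<delta> \<le> dist (A, B, l, m) (A0, B0, l0, m0)"
    have large: "real T \<ge> N1" "real T \<ge> N2" "real T \<ge> N3" "real T \<ge> N4" "real T \<ge> 2 * real k"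
        "real S \<ge> N3" "real S \<ge> 2 * real k"
      using N TS pos k0 by (auto intro: order_trans[of _ "real N"])
    have TS0: "real T > 0" "real S > 0" using large pos by linarith+
    let ?h = "\<lambda>t s. sinusoid (A0, B0, l0, m0) t s - sinusoid (A, B, l, m) t s"
    show "\<kappa> * (real T * real S) \<le> (\<Sum>t=1..T. \<Sum>s=1..S. (?h t s)\<^sup>2)"
    proof (cases "L \<le> real T * \<bar>l0 - l\<bar> \<or> L \<le> real S * \<bar>m0 - m\<bar>")
      case True
      have "\<rho> / sin l0 / T \<le> \<rho> / 16" 
        using large(1) sin \<rho> TS0 by (simp add: N1_def field_simps)
      moreover have "4 * R\<^sup>2 / c / T \<le> \<rho> / 16"
        using large(2) c \<rho> TS0 by (simp add: N2_def field_simps)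
      moreover have "4 * R\<^sup>2 * (pi / L) = \<rho> / 8"
        using R \<rho> by (simp add: L_def field_simps)
      ultimately have "\<kappa> \<le> \<rho> / 2 - \<rho> / sin l0 / T - 4 * R\<^sup>2 / c / T - 4 * R\<^sup>2 * (pi / L)"
        unfolding \<kappa>_def by linarith
      then have "\<kappa> * (real T * real S) \<le> (real T * real S) * (\<rho> / 2 - \<rho> / sin l0 / T - 4 * R\<^sup>2 / c / T - 4 * R\<^sup>2 * (pi / L))"
        by (subst mult.commute) (intro mult_left_mono, auto)
      also have "\<dots> \<le> (\<Sum>t=1..T. \<Sum>s=1..S. (?h t s)\<^sup>2)"
        unfolding \<rho>_def c_def using True l0 lm m0 bd0 bd L TS0
        by (intro sum_square_diff_ge_far_frequencies) auto
      finally show ?thesis .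
    next
      case False
      define T' S' where "T' = T div k" and "S' = S div k"
      have half: "real n / (2 * real k) \<le> real (n div k)" if "real n \<ge> 2 * real k" for n
      proof -
        have "1 \<le> real n / (2 * real k)" using that k0 by simp
        moreover have "real n / real k = real n / (2 * real k) + real n / (2 * real k)" by simp
        ultimately show ?thesis using real_div_ge[OF k0, of n] by linarith
      qed
      have T': "real T / (2 * real k) \<le> real T'" and S': "real S / (2 * real k) \<le> real S'"
        using half large by (auto simp: T'_def S'_def)
      have T'pos: "real T' > 0" using T' TS0 k0 by (smt (verit) divide_pos_pos)
      have T'4: "4 / sin l0 \<le> real T'"
      proof -
        have "4 / sin l0 + 1 \<le> real T / real k" using large(4) k0 by (simp add: N4_def field_simps)
        then show ?thesis using real_div_ge[OF k0, of T] unfolding T'_def by linarith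
      qed
      define d where "d = L / real k"
      have near: "real T' * \<bar>l0 - l\<bar> \<le> d" "real S' * \<bar>m0 - m\<bar> \<le> d"
      proof -
        have "real T' * \<bar>l0 - l\<bar> \<le> real T / real k * \<bar>l0 - l\<bar>"
          unfolding T'_def by (intro mult_right_mono of_nat_div_le_of_nat) auto
        also have "\<dots> \<le> L / real k" using False by (simp add: divide_right_mono)
        finally show "real T' * \<bar>l0 - l\<bar> \<le> d" by (simp add: d_def)
        have "real S' * \<bar>m0 - m\<bar> \<le> real S / real k * \<bar>m0 - m\<bar>"
          unfolding S'_def by (intro mult_right_mono of_nat_div_le_of_nat) auto
        also have "\<dots> \<le> L / real k" using False by (simp add: divide_right_mono)
        finally show "real S' * \<bar>m0 - m\<bar> \<le> d" by (simp add: d_def)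
      qed
      define q where "q = (A0 - A)\<^sup>2 + (B0 - B)\<^sup>2"
      have freq: "\<bar>x\<bar> \<le> \<delta> / 4" if "\<not> L \<le> n * \<bar>x\<bar>" "n \<ge> N3" for x n
      proof -
        have "N3 * \<bar>x\<bar> \<le> L" using that mult_right_mono[of N3 n "\<bar>x\<bar>"] by auto
        then show ?thesis using L \<delta> by (simp add: N3_def field_simps)
      qed
      have "\<bar>l0 - l\<bar> \<le> \<delta> / 4" "\<bar>m0 - m\<bar> \<le> \<delta> / 4"
        using freq[where n = "real T" and x = "l0 - l"] freq[where n = "real S" and x = "m0 - m"] False large
        by auto
      moreover have "\<delta> \<le> \<bar>A0 - A\<bar> + (\<bar>B0 - B\<bar> + (\<bar>l0 - l\<bar> + \<bar>m0 - m\<bar>))"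
        using dist dist_Pair_le[of A "(B, l, m)" A0 "(B0, l0, m0)"] dist_Pair_le[of B "(l, m)" B0 "(l0, m0)"]
          dist_Pair_le[of l m l0 m0] by (simp add: dist_real_def abs_minus_commute)
      \<comment> \<open>The two frequencies account for at most half of the distance, so the
        amplitudes carry the rest.\<close>
      ultimately have "\<delta> / 2 \<le> \<bar>A0 - A\<bar> + \<bar>B0 - B\<bar>" by linarith
      then have "(\<delta> / 2)\<^sup>2 \<le> (\<bar>A0 - A\<bar> + \<bar>B0 - B\<bar>)\<^sup>2" using \<delta> by (intro power_mono) auto
      also have "\<dots> \<le> 2 * q"
        using zero_le_power2[of "\<bar>A0 - A\<bar> - \<bar>B0 - B\<bar>"] by (simp add: q_def power2_sum power2_diff)
      finally have q: "\<delta>\<^sup>2 / 8 \<le> q" by (simp add: power2_eq_square)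
      have Rd: "(4 * R * d)\<^sup>2 \<le> (\<delta> / 16)\<^sup>2"
        using k R L \<delta> k0 by (intro power_mono) (auto simp: d_def field_simps)
      have "q / sin l0 / 2 / real T' \<le> q / 8"
      proof -
        have "q * 4 \<le> q * (real T' * sin l0)"
          using T'4 sin by (intro mult_left_mono) (auto simp: field_simps q_def)
        then show ?thesis using sin T'pos by (simp add: field_simps)
      qed
      moreover have "\<delta>\<^sup>2 / 128 \<le> q / 4 - u - v" if "u \<le> q / 8" "v \<le> (\<delta> / 16)\<^sup>2" for u v
      proof -
        have "v \<le> \<delta>\<^sup>2 / 256" using that by (simp add: power_divide)
        then show ?thesis using q that(1) zero_le_power2[of \<delta>] by linarith
      qed
      ultimately have *: "\<delta>\<^sup>2 / 128 \<le> q / 4 - q / sin l0 / 2 / real T' - (4 * R * d)\<^sup>2"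
        using Rd by blast
      have "\<kappa> * (real T * real S) \<le> \<delta>\<^sup>2 / (512 * (real k)\<^sup>2) * (real T * real S)"
        by (intro mult_right_mono) (auto simp: \<kappa>_def)
      also have "\<dots> = \<delta>\<^sup>2 / 128 * (real T / (2 * real k) * (real S / (2 * real k)))"
        by (simp add: power2_eq_square)
      also have "\<dots> \<le> \<delta>\<^sup>2 / 128 * (real T' * real S')"
        using T' S' by (intro mult_left_mono mult_mono) auto
      also have "\<dots> \<le> (q / 4 - q / sin l0 / 2 / real T' - (4 * R * d)\<^sup>2) * (real T' * real S')"
        using * by (intro mult_right_mono) auto
      also have "\<dots> = q / 4 * (real T' * real S') - q * real S' / sin l0 / 2 - (real T' * real S') * (4 * R * d)\<^sup>2"
        using T'pos by (simp add: algebra_simps)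
      also have "\<dots> \<le> (\<Sum>t=1..T'. \<Sum>s=1..S'. (?h t s)\<^sup>2)"
        unfolding q_def by (intro sum_square_diff_ge_near_frequencies l0 bd near)
      also have "\<dots> \<le> (\<Sum>t=1..T. \<Sum>s=1..S. (?h t s)\<^sup>2)"
        \<comment> \<open>Passing from the corner to the whole rectangle only adds nonnegative
          terms.\<close>
        by (rule order_trans[OF sum_mono sum_mono2])
           (auto intro!: sum_mono2 sum_nonneg simp: T'_def S'_def simp del: sinusoid.simps
                 intro: order_trans[OF _ div_le_dividend])
      finally show ?thesis .
    qed
  qed
qed

section \<open>Mean excess of the absolute error\<close>

text \<open>This is the function \<open>\<phi>\<close> of the introduction. Subtracting
  \<open>\<bar>X \<omega>\<bar>\<close> confines the integrand to values between
  \<open>- \<bar>h\<bar>\<close> and \<open>\<bar>h\<bar>\<close>, which gives integrability and the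
  range used in Hoeffding's inequality.\<close>

definition shift_risk :: "'w measure \<Rightarrow> ('w \<Rightarrow> real) \<Rightarrow> real \<Rightarrow> real" where
  "shift_risk M X h = (\<integral>\<omega>. \<bar>X \<omega> + h\<bar> - \<bar>X \<omega>\<bar> \<partial>M)"

lemma shift_risk_cong_distr:
  assumes "X \<in> borel_measurable M" "Y \<in> borel_measurable M" "distr M borel X = distr M borel Y"
  shows "shift_risk M X h = shift_risk M Y h"
proof -
  have "shift_risk M Z h = (\<integral>x. \<bar>x + h\<bar> - \<bar>x\<bar> \<partial>distr M borel Z)" if "Z \<in> borel_measurable M" for Z
    unfolding shift_risk_def using that by (subst integral_distr) auto
  then show ?thesis using assms by simp
qed

context prob_space
begin

lemma integrable_abs_shift:
  fixes X :: "'a \<Rightarrow> real"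
  assumes [measurable]: "X \<in> borel_measurable M"
  shows "integrable M (\<lambda>\<omega>. \<bar>X \<omega> + h\<bar> - \<bar>X \<omega>\<bar>)"
  by (rule integrable_const_bound[where B = "\<bar>h\<bar>"]) auto

text \<open>The 1-Lipschitz property allows a parameter to be replaced by a nearby net
  point.\<close>

lemma shift_risk_diff_le:
  assumes "X \<in> borel_measurable M"
  shows "shift_risk M X h - shift_risk M X h' \<le> \<bar>h - h'\<bar>"
proof -
  have "shift_risk M X h \<le> (\<integral>\<omega>. \<bar>X \<omega> + h'\<bar> - \<bar>X \<omega>\<bar> + \<bar>h - h'\<bar> \<partial>M)"
    unfolding shift_risk_def
    by (intro integral_mono integrable_abs_shift Bochner_Integration.integrable_add assms) auto
  also have "\<dots> = shift_risk M X h' + \<bar>h - h'\<bar>"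
    by (simp add: shift_risk_def Bochner_Integration.integral_add[OF integrable_abs_shift[OF assms]] prob_space)
  finally show ?thesis by simp
qed

text \<open>Convexity together with the value zero at zero: the slope of a chord from the origin
  does not decrease along a ray.\<close>

lemma shift_risk_scale_le:
  assumes X: "X \<in> borel_measurable M" and u: "0 \<le> u" "u \<le> 1"
  shows "shift_risk M X (u * h) \<le> u * shift_risk M X h"
proof -
  have "\<bar>x + u * h\<bar> - \<bar>x\<bar> \<le> u * (\<bar>x + h\<bar> - \<bar>x\<bar>)" for x
  proof -
    have "x + u * h = u * (x + h) + (1 - u) * x" by (simp add: algebra_simps)
    also have "\<bar>\<dots>\<bar> \<le> u * \<bar>x + h\<bar> + (1 - u) * \<bar>x\<bar>"
      using abs_triangle_ineq[of "u * (x + h)" "(1 - u) * x"] u by (simp add: abs_mult)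
    finally show ?thesis by (simp add: algebra_simps)
  qed
  then have "shift_risk M X (u * h) \<le> (\<integral>\<omega>. u * (\<bar>X \<omega> + h\<bar> - \<bar>X \<omega>\<bar>) \<partial>M)"
    unfolding shift_risk_def by (intro integral_mono integrable_abs_shift integrable_mult_right X) auto
  then show ?thesis by (simp add: shift_risk_def)
qed

lemma shift_risk_pos:
  assumes X [measurable]: "X \<in> borel_measurable M"
    and median: "cdf (distr M borel X) 0 = 1 / 2"
    and unique: "\<And>x. cdf (distr M borel X) x = 1 / 2 \<Longrightarrow> x = 0"
    and h: "h \<noteq> 0"
  shows "shift_risk M X h > 0"
proof -
  have cdf: "cdf (distr M borel X) x = (\<integral>\<omega>. indicator {..x} (X \<omega>) \<partial>M)" for x
  proof -
    have "(\<integral>z. indicator {..x} z \<partial>distr M borel X) = (\<integral>\<omega>. indicator {..x} (X \<omega>) \<partial>M :: real)"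
      by (rule integral_distr) auto
    then show ?thesis by (simp add: cdf_def)
  qed
  have int: "integrable M (\<lambda>\<omega>. indicator {..x} (X \<omega>) :: real)" for x
    by (rule integrable_const_bound[where B = 1]) auto
  define F :: "real \<Rightarrow> real" where "F x = (\<integral>\<omega>. indicator {..x} (X \<omega>) \<partial>M)" for x
  have F0: "F 0 = 1 / 2" using median by (simp add: cdf F_def)
  have mono: "F x \<le> F y" if "x \<le> y" for x y
    unfolding F_def using that by (intro integral_mono int) (auto simp: indicator_def)
  have uniq: "F x \<noteq> 1 / 2" if "x \<noteq> 0" for x using unique[of x] that by (auto simp: cdf F_def)
  \<comment> \<open>The map \<open>x \<mapsto> \<bar>x + h\<bar> - \<bar>x\<bar>\<close> dominates a step function jumping at \<open>0\<close> and at \<open>- h / 2\<close>;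
    \<open>F (- h / 2) \<noteq> F 0\<close> makes its expectation positive.\<close>
  show ?thesis
  proof (cases "h > 0")
    case True
    have "h * (1 - F 0 - F (- h / 2)) =
        (\<integral>\<omega>. h * (1 - indicator {..0} (X \<omega>) - indicator {..- h / 2} (X \<omega>)) \<partial>M)"
      by (simp add: F_def int Bochner_Integration.integral_diff prob_space)
    also have "\<dots> \<le> shift_risk M X h"
      unfolding shift_risk_def using True
      by (intro integral_mono integrable_abs_shift X integrable_mult_right Bochner_Integration.integrable_diff int)
         (auto simp: indicator_def abs_if)
    finally have "h * (1 - F 0 - F (- h / 2)) \<le> shift_risk M X h" .
    moreover have "F (- h / 2) < 1 / 2" using mono[of "- h / 2" 0] uniq[of "- h / 2"] F0 True by auto
    then have "0 < h * (1 - F 0 - F (- h / 2))" using True F0 by simp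
    ultimately show ?thesis by linarith
  next
    case False
    then have neg: "- h > 0" using h by simp
    have "(- h) * (F 0 + F (- h / 2) - 1) =
        (\<integral>\<omega>. (- h) * (indicator {..0} (X \<omega>) + indicator {..- h / 2} (X \<omega>) - 1) \<partial>M)"
      by (simp add: F_def int Bochner_Integration.integral_diff Bochner_Integration.integral_add prob_space)
    also have "\<dots> \<le> shift_risk M X h"
      unfolding shift_risk_def using neg
      by (intro integral_mono integrable_abs_shift X integrable_mult_right Bochner_Integration.integrable_diff
          Bochner_Integration.integrable_add int)
         (auto simp: indicator_def abs_if)
    finally have "(- h) * (F 0 + F (- h / 2) - 1) \<le> shift_risk M X h" .
    moreover have "F (- h / 2) > 1 / 2" using mono[of 0 "- h / 2"] uniq[of "- h / 2"] F0 neg by auto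
    then have "0 < (- h) * (F 0 + F (- h / 2) - 1)" using neg F0 by (intro mult_pos_pos) auto
    ultimately show ?thesis by linarith
  qed
qed

text \<open>Beyond \<open>\<eta>\<close> the chord slope is at least the smaller of the two slopes
  at \<open>\<eta>\<close> and \<open>- \<eta>\<close>, which is \<open>c\<close>. Near zero the
  growth need not be linear; the offset \<open>\<eta>\<close> makes the bound nonpositive
  there.\<close>

lemma shift_risk_ge_linear:
  assumes X: "X \<in> borel_measurable M"
    and median: "cdf (distr M borel X) 0 = 1 / 2"
    and unique: "\<And>x. cdf (distr M borel X) x = 1 / 2 \<Longrightarrow> x = 0"
    and \<eta>: "\<eta> > 0"
  obtains c where "c > 0" "\<And>h. c * (\<bar>h\<bar> - \<eta>) \<le> shift_risk M X h"
proof -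
  note pos = shift_risk_pos[OF X median unique]
  have nonneg: "shift_risk M X h \<ge> 0" for h
    using pos[of h] by (cases "h = 0") (auto simp: shift_risk_def)
  define c where "c = min (shift_risk M X \<eta>) (shift_risk M X (- \<eta>)) / \<eta>"
  have c: "c > 0" using \<eta> pos[of \<eta>] pos[of "- \<eta>"] by (auto simp: c_def)
  moreover have "c * (\<bar>h\<bar> - \<eta>) \<le> shift_risk M X h" for h
  proof (cases "\<bar>h\<bar> \<le> \<eta>")
    case True
    then have "c * (\<bar>h\<bar> - \<eta>) \<le> 0" using c by (intro mult_nonneg_nonpos) auto
    then show ?thesis using nonneg[of h] by linarith
  next
    case False
    have "\<eta> / \<bar>h\<bar> * h \<in> {\<eta>, - \<eta>}" using False \<eta> by (auto simp: abs_if)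
    then have "c * \<eta> \<le> shift_risk M X (\<eta> / \<bar>h\<bar> * h)" using \<eta> by (auto simp: c_def)
    also have "\<dots> \<le> \<eta> / \<bar>h\<bar> * shift_risk M X h"
      using False \<eta> by (intro shift_risk_scale_le X) auto
    finally have "c * \<bar>h\<bar> \<le> shift_risk M X h" using False \<eta> by (simp add: field_simps)
    moreover have "c * (\<bar>h\<bar> - \<eta>) \<le> c * \<bar>h\<bar>" using c \<eta> by simp
    ultimately show ?thesis by linarith
  qed
  ultimately show thesis by (rule that)
qed

text \<open>Hoeffding's inequality for independent terms with values in an interval of length
  \<open>2 * H\<close>; the deviation is proportional to the number of terms, hence an exponent
  linear in \<open>card I\<close>.\<close>

lemma prob_sum_abs_shift_le:
  assumes indep: "indep_vars (\<lambda>_. borel) X I" and I: "finite I" "I \<noteq> {}"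
    and H: "\<And>i. i \<in> I \<Longrightarrow> \<bar>h i\<bar> \<le> H" "H > 0" and \<kappa>: "\<kappa> > 0"
  shows "prob {\<omega> \<in> space M. (\<Sum>i\<in>I. \<bar>X i \<omega> + h i\<bar> - \<bar>X i \<omega>\<bar>)
             \<le> (\<Sum>i\<in>I. shift_risk M (X i) (h i)) - \<kappa> * real (card I)}
    \<le> exp (- (\<kappa>\<^sup>2 / (2 * H\<^sup>2) * real (card I)))"
proof -
  interpret Hoeffding_ineq M I "\<lambda>i \<omega>. \<bar>X i \<omega> + h i\<bar> - \<bar>X i \<omega>\<bar>" "\<lambda>_. - H" "\<lambda>_. H"
      "\<Sum>i\<in>I. shift_risk M (X i) (h i)"
  proof unfold_locales
    show "indep_vars (\<lambda>_. borel) (\<lambda>i \<omega>. \<bar>X i \<omega> + h i\<bar> - \<bar>X i \<omega>\<bar>) I"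
      by (rule indep_vars_compose2[OF indep, where Y = "\<lambda>i x. \<bar>x + h i\<bar> - \<bar>x\<bar>"]) auto
    show "AE \<omega> in M. \<bar>X i \<omega> + h i\<bar> - \<bar>X i \<omega>\<bar> \<in> {- H..H}" if "i \<in> I" for i
      using H(1)[OF that] by (intro AE_I2) auto
  qed (auto simp: I shift_risk_def)
  have n: "real (card I) > 0" using I by (simp add: card_gt_0_iff)
  have sumH: "(\<Sum>i\<in>I. (H - - H)\<^sup>2) = card I * (4 * H\<^sup>2)" by (simp add: power2_eq_square)
  have expo: "- 2 * (\<kappa> * real (card I))\<^sup>2 / (real (card I) * (4 * H\<^sup>2)) = - (\<kappa>\<^sup>2 / (2 * H\<^sup>2) * card I)"
    using n H(2) by (simp add: field_simps power2_eq_square)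
  then show ?thesis
    using Hoeffding_ineq_le[of "\<kappa> * real (card I)"] \<kappa> n H(2) unfolding sumH expo by simp
qed

end

section \<open>Uniform lower bound\<close>

text \<open>With mesh \<open>1 / (n * k)\<close> in every coordinate, rounding changes each phase at
  indices up to \<open>n\<close> by at most \<open>2 / k\<close>. A coordinate takes at most
  \<open>2 * R * n * k + 1\<close> values, whence the fourth power of \<open>n\<close>.\<close>

lemma sinusoid_net:
  fixes R :: nat
  assumes "R > 0" "d > 0"
  obtains C :: real and net :: "nat \<Rightarrow> param set" where
    "\<And>n. n > 0 \<Longrightarrow> finite (net n) \<and> card (net n) \<le> C * real n ^ 4"
    "\<And>n A B l m. (A, B, l, m) \<in> net n \<Longrightarrow> \<bar>A\<bar> \<le> real R \<and> \<bar>B\<bar> \<le> real R"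
    "\<And>n A B l m. n > 0 \<Longrightarrow> \<bar>A\<bar> \<le> real R \<Longrightarrow> \<bar>B\<bar> \<le> real R \<Longrightarrow> \<bar>l\<bar> \<le> real R \<Longrightarrow> \<bar>m\<bar> \<le> real R \<Longrightarrow>
       \<exists>\<theta>\<in>net n. \<forall>t\<le>n. \<forall>s\<le>n. \<bar>sinusoid (A, B, l, m) t s - sinusoid \<theta> t s\<bar> \<le> d"
proof -
  \<comment> \<open>The two amplitude errors contribute at most \<open>1 / k\<close> each and the
    phase error at most \<open>2 * R * (2 / k)\<close>.\<close>
  obtain k :: nat where k: "(2 + 4 * real R) / d < real k" using reals_Archimedean2 by blast
  have k0: "real k > 0" using k assms by (smt (verit) divide_pos_pos of_nat_0_le_iff)
  define grid where "grid n = (\<lambda>i. of_int i / (real n * real k)) ` {- int (R * n * k)..int (R * n * k)}" for n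
  define net :: "nat \<Rightarrow> param set" where "net n = grid n \<times> grid n \<times> grid n \<times> grid n" for n
  define C where "C = (2 * real R * real k + 1) ^ 4"
  have fin: "finite (grid n)" for n by (simp add: grid_def)
  have card: "real (card (grid n)) \<le> (2 * real R * real k + 1) * n" if "n > 0" for n
  proof -
    have "card (grid n) \<le> card {- int (R * n * k)..int (R * n * k)}"
      unfolding grid_def by (rule card_image_le) simp
    also have "\<dots> = nat (int (2 * (R * n * k) + 1))" by (simp add: algebra_simps)
    also have "\<dots> = 2 * (R * n * k) + 1" by (rule nat_int)
    finally have "real (card (grid n)) \<le> real (2 * (R * n * k) + 1)" by (rule of_nat_mono)
    then show ?thesis using that by (simp add: algebra_simps)
  qed
  have grid_bd: "\<bar>x\<bar> \<le> real R" if "x \<in> grid n" for x n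
  proof -
    from that obtain i where "i \<in> {- int (R * n * k)..int (R * n * k)}" and x: "x = of_int i / (real n * real k)"
      by (auto simp: grid_def simp del: of_nat_mult)
    then have i: "\<bar>i\<bar> \<le> int (R * n * k)" by (auto simp: abs_le_iff simp del: of_nat_mult)
    have "\<bar>real_of_int i\<bar> \<le> real R * (real n * real k)"
    proof -
      have "real_of_int \<bar>i\<bar> \<le> real_of_int (int (R * n * k))" using i by (simp only: of_int_le_iff)
      then show ?thesis by (simp add: mult.assoc)
    qed
    then show ?thesis using k0 x by (cases "n = 0") (auto simp: abs_divide abs_mult divide_le_eq)
  qed
  show thesis
  proof (rule that[of net C])
    fix n :: nat assume n: "n > 0"
    have "real (card (net n)) = real (card (grid n)) ^ 4"
      by (simp add: net_def card_cartesian_product power4_eq_xxxx)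
    also have "\<dots> \<le> ((2 * real R * real k + 1) * n) ^ 4" using card[OF n] by (intro power_mono) auto
    also have "\<dots> = C * real n ^ 4" by (simp add: C_def power_mult_distrib)
    finally show "finite (net n) \<and> card (net n) \<le> C * real n ^ 4" using fin by (simp add: net_def)
  next
    fix n :: nat and A B l m :: real assume *: "(A, B, l, m) \<in> net n"
    then show "\<bar>A\<bar> \<le> real R \<and> \<bar>B\<bar> \<le> real R" using grid_bd by (auto simp: net_def)
  next
    fix n :: nat and A B l m :: real
    assume n: "n > 0" and bd: "\<bar>A\<bar> \<le> real R" "\<bar>B\<bar> \<le> real R" "\<bar>l\<bar> \<le> real R" "\<bar>m\<bar> \<le> real R"
    have pos: "real n * real k > 0" using n k0 by simp
    \<comment> \<open>Rounding down to the grid. Since \<open>R\<close> is a natural number, the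
      ends of the interval from \<open>- R\<close> to \<open>R\<close> are grid points and rounding
      does not leave it.\<close>
    define r where "r x = of_int \<lfloor>x * (real n * real k)\<rfloor> / (real n * real k)" for x
    have r_grid: "r x \<in> grid n" if "\<bar>x\<bar> \<le> real R" for x
    proof -
      have "\<bar>x * (real n * real k)\<bar> \<le> real R * (real n * real k)"
        using that pos unfolding abs_mult by (intro mult_mono) auto
      then have "- int (R * n * k) \<le> \<lfloor>x * (real n * real k)\<rfloor>" "\<lfloor>x * (real n * real k)\<rfloor> \<le> int (R * n * k)"
        by (auto simp: le_floor_iff floor_le_iff abs_le_iff algebra_simps)
      then show ?thesis by (auto simp: grid_def r_def)
    qed
    have rAB: "\<bar>r A\<bar> \<le> real R" "\<bar>r B\<bar> \<le> real R" using bd by (auto intro!: grid_bd r_grid)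
    have r_close: "\<bar>x - r x\<bar> \<le> 1 / (real n * real k)" for x
    proof -
      have "\<bar>x * (real n * real k) - of_int \<lfloor>x * (real n * real k)\<rfloor>\<bar> \<le> 1" by linarith
      moreover have "x - r x = (x * (real n * real k) - of_int \<lfloor>x * (real n * real k)\<rfloor>) / (real n * real k)"
        using n k0 by (simp add: r_def diff_divide_distrib)
      ultimately show ?thesis using pos by (simp add: abs_divide divide_right_mono)
    qed
    have "\<bar>sinusoid (A, B, l, m) t s - sinusoid (r A, r B, r l, r m) t s\<bar> \<le> d" if ts: "t \<le> n" "s \<le> n" for t s
    proof -
      have "\<bar>x - r x\<bar> * real t \<le> 1 / real k" if "t \<le> n" for x t
      proof -
        have "\<bar>x - r x\<bar> * real t \<le> 1 / (real n * real k) * real n"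
          using r_close[of x] that pos by (intro mult_mono) auto
        then show ?thesis using n by simp
      qed
      from this[OF ts(1), of l] this[OF ts(2), of m]
      have "\<bar>l - r l\<bar> * real t + \<bar>m - r m\<bar> * real s \<le> 2 / real k" by simp
      then have "2 * R * (\<bar>l - r l\<bar> * real t + \<bar>m - r m\<bar> * real s) \<le> 2 * R * (2 / real k)"
        by (intro mult_left_mono) auto
      moreover have "1 / (real n * real k) \<le> 1 / real k" using n k0 by (simp add: field_simps)
      ultimately have "\<bar>A - r A\<bar> + \<bar>B - r B\<bar> + 2 * R * (\<bar>l - r l\<bar> * real t + \<bar>m - r m\<bar> * real s)
          \<le> 1 / real k + 1 / real k + 2 * R * (2 / real k)"
        using r_close[of A] r_close[of B] by linarith
      also have "\<dots> = (2 + 4 * real R) / k" by (simp add: add_divide_distrib)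
      also have "\<dots> \<le> d" using k k0 assms by (simp add: field_simps)
      finally show ?thesis
        using abs_sinusoid_diff_le[OF rAB, of A B l m t s "r l" "r m"] by linarith
    qed
    then show "\<exists>\<theta>\<in>net n. \<forall>t\<le>n. \<forall>s\<le>n. \<bar>sinusoid (A, B, l, m) t s - sinusoid \<theta> t s\<bar> \<le> d"
      using bd by (intro bexI[of _ "(r A, r B, r l, r m)"]) (auto simp: net_def r_grid simp del: sinusoid.simps)
  qed
qed

text \<open>The exceptional null set and \<open>N\<close> are fixed before the rectangle and the
  parameter, so the bound may be applied to a random minimizer. Indexing by the area turns the
  double family of rectangles into one sequence for Borel-Cantelli.\<close>

lemma (in prob_space) AE_uniform_abs_shift_lower_bound:
  fixes \<epsilon> :: "nat \<Rightarrow> nat \<Rightarrow> 'a \<Rightarrow> real" and R :: nat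
  assumes indep: "indep_vars (\<lambda>_. borel) (\<lambda>(t, s). \<epsilon> t s) ({1..} \<times> {1..})"
    and R: "R > 0" "\<bar>A0\<bar> \<le> real R" "\<bar>B0\<bar> \<le> real R" and \<kappa>: "\<kappa> > 0"
  shows "AE \<omega> in M. \<exists>N. \<forall>T S A B l m. T \<ge> 1 \<longrightarrow> S \<ge> 1 \<longrightarrow> T * S \<ge> N \<longrightarrow>
    \<bar>A\<bar> \<le> real R \<longrightarrow> \<bar>B\<bar> \<le> real R \<longrightarrow> \<bar>l\<bar> \<le> real R \<longrightarrow> \<bar>m\<bar> \<le> real R \<longrightarrow>
    (\<Sum>t=1..T. \<Sum>s=1..S. shift_risk M (\<epsilon> t s) (sinusoid (A0, B0, l0, m0) t s - sinusoid (A, B, l, m) t s))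
        - \<kappa> * (real T * real S)
      \<le> (\<Sum>t=1..T. \<Sum>s=1..S.
           \<bar>\<epsilon> t s \<omega> + (sinusoid (A0, B0, l0, m0) t s - sinusoid (A, B, l, m) t s)\<bar> - \<bar>\<epsilon> t s \<omega>\<bar>)"
proof -
  define X where "X = (\<lambda>(t, s). \<epsilon> t s)"
  define h where "h \<theta> = (\<lambda>(t, s). sinusoid (A0, B0, l0, m0) t s - sinusoid \<theta> t s)" for \<theta>
  \<comment> \<open>Both sides of a rectangle of area \<open>n\<close> are at most \<open>n\<close>,
    so the net for index \<open>n\<close> serves all of them.\<close>
  define box where "box n = {(T, S) \<in> {1..n} \<times> {1..n}. T * S = n}" for n :: nat
  define I where "I p = {1..fst p} \<times> {1..snd p}" for p :: "nat \<times> nat"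
  define H where "H = 4 * real R"
  \<comment> \<open>The tolerance is spent three times: on passing to the net point in the risk, on
    the Hoeffding deviation, and on passing back in the observed sum.\<close>
  define d where "d = \<kappa> / 3"
  have H: "H > 0" and d: "d > 0" using R \<kappa> by (auto simp: H_def d_def)
  obtain C net where
    net: "\<And>n. n > 0 \<Longrightarrow> finite (net n) \<and> real (card (net n)) \<le> C * real n ^ 4" and
    net_bd: "\<And>n A B l m. (A, B, l, m) \<in> net n \<Longrightarrow> \<bar>A\<bar> \<le> real R \<and> \<bar>B\<bar> \<le> real R" and
    net_close: "\<And>n A B l m. n > 0 \<Longrightarrow> \<bar>A\<bar> \<le> real R \<Longrightarrow> \<bar>B\<bar> \<le> real R \<Longrightarrow> \<bar>l\<bar> \<le> real R \<Longrightarrow> \<bar>m\<bar> \<le> real R \<Longrightarrow>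
       \<exists>\<theta>\<in>net n. \<forall>t\<le>n. \<forall>s\<le>n. \<bar>sinusoid (A, B, l, m) t s - sinusoid \<theta> t s\<bar> \<le> d"
    by (rule sinusoid_net[OF R(1) d]) blast
  have X_rv [measurable]: "X i \<in> borel_measurable M" if "i \<in> {1..} \<times> {1..}" for i
    using indep that unfolding X_def indep_vars_def by blast
  have I: "finite (I p)" "I p \<subseteq> {1..} \<times> {1..}" "real (card (I p)) = real (fst p) * real (snd p)" for p
    by (auto simp: I_def)
  define bad where "bad p \<theta> = {\<omega> \<in> space M. (\<Sum>i\<in>I p. \<bar>X i \<omega> + h \<theta> i\<bar> - \<bar>X i \<omega>\<bar>)
      \<le> (\<Sum>i\<in>I p. shift_risk M (X i) (h \<theta> i)) - d * real (card (I p))}" for p \<theta>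
  define Bad where "Bad n = (\<Union>p\<in>box n. \<Union>\<theta>\<in>net n. bad p \<theta>)" for n
  define a where "a = d\<^sup>2 / (2 * H\<^sup>2)"
  have a: "a > 0" using d H by (simp add: a_def)
  have bad_sets [measurable]: "bad p \<theta> \<in> sets M" for p \<theta>
  proof -
    have "(\<lambda>\<omega>. \<Sum>i\<in>I p. \<bar>X i \<omega> + h \<theta> i\<bar> - \<bar>X i \<omega>\<bar>) \<in> borel_measurable M"
      using I(2)[of p] by (intro borel_measurable_sum borel_measurable_diff borel_measurable_abs
          borel_measurable_add X_rv) auto
    then show ?thesis unfolding bad_def by measurable
  qed
  have box: "finite (box n)" "card (box n) \<le> n * n" for n
  proof -
    have sub: "box n \<subseteq> {1..n} \<times> {1..n}" by (auto simp: box_def)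
    show "finite (box n)" using finite_subset[OF sub] by simp
    show "card (box n) \<le> n * n" using card_mono[OF _ sub] by simp
  qed
  have bad_prob: "prob (bad p \<theta>) \<le> exp (- (a * real n))" if "p \<in> box n" "\<theta> \<in> net n" for p \<theta> n
  proof -
    have pn: "real (card (I p)) = real n" "n > 0"
      using that(1) unfolding I(3) by (auto simp: box_def simp flip: of_nat_mult)
    obtain A B l m where \<theta>: "\<theta> = (A, B, l, m)" by (cases \<theta>)
    have AB: "\<bar>A\<bar> \<le> real R" "\<bar>B\<bar> \<le> real R" using net_bd that(2) \<theta> by blast+
    have "\<bar>h \<theta> i\<bar> \<le> H" for i
    proof (cases i)
      case (Pair t s)
      show ?thesis
        using abs_sinusoid_le[OF R(2,3), of l0 m0 t s] abs_sinusoid_le[OF AB, of l m t s]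
        unfolding Pair h_def H_def \<theta> split by linarith
    qed
    moreover have "indep_vars (\<lambda>_. borel) X (I p)"
      using indep_vars_subset[OF indep I(2)[of p]] by (simp add: X_def)
    moreover have "I p \<noteq> {}" using pn by auto
    ultimately have "prob (bad p \<theta>) \<le> exp (- (d\<^sup>2 / (2 * H\<^sup>2) * real (card (I p))))"
      unfolding bad_def using I(1) H d by (intro prob_sum_abs_shift_le) auto
    then show ?thesis by (simp add: a_def pn)
  qed
  have Bad_sets: "Bad n \<in> sets M" if "n > 0" for n
    unfolding Bad_def using net[OF that] box by (intro sets.finite_UN bad_sets) auto
  have Bad_prob: "prob (Bad n) \<le> C * real n ^ 6 * exp (- (a * real n))" if n: "n > 0" for n
  proof -
    have "prob (Bad n) \<le> (\<Sum>p\<in>box n. prob (\<Union>\<theta>\<in>net n. bad p \<theta>))"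
      unfolding Bad_def using net[OF n] box
      by (intro finite_measure_subadditive_finite) (auto intro!: sets.finite_UN)
    also have "\<dots> \<le> (\<Sum>p\<in>box n. \<Sum>\<theta>\<in>net n. prob (bad p \<theta>))"
      using net[OF n] by (intro sum_mono finite_measure_subadditive_finite) auto
    also have "\<dots> \<le> (\<Sum>p\<in>box n. \<Sum>\<theta>\<in>net n. exp (- (a * real n)))"
      by (intro sum_mono bad_prob)
    also have "\<dots> = real (card (box n)) * (real (card (net n)) * exp (- (a * real n)))" by simp
    also have "\<dots> \<le> real (n * n) * (C * real n ^ 4 * exp (- (a * real n)))"
      using net[OF n] box(2)[of n] by (intro mult_mono mult_right_mono of_nat_mono) auto
    also have "\<dots> = C * real n ^ 6 * exp (- (a * real n))" by (simp add: eval_nat_numeral)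
    finally show ?thesis .
  qed
  \<comment> \<open>The index is shifted because the net and the probability bound are available
    only for positive areas.\<close>
  have "AE \<omega> in M. eventually (\<lambda>n. \<omega> \<in> space M - Bad (Suc n)) sequentially"
  proof (rule borel_cantelli_AE1)
    show "summable (\<lambda>n. prob (Bad (Suc n)))"
    proof (rule summable_comparison_test_ev)
      have "eventually (\<lambda>n. C * real (Suc n) ^ 6 * exp (- (a * real (Suc n))) \<le> inverse (real (Suc n) ^ 2)) sequentially"
        using a by real_asymp
      then show "eventually (\<lambda>n. norm (prob (Bad (Suc n))) \<le> inverse (real (Suc n) ^ 2)) sequentially"
        by eventually_elim (use Bad_prob order_trans in fastforce)
      show "summable (\<lambda>n. inverse (real (Suc n) ^ 2))"
        using inverse_power_summable[of 2, where ?'a = real] by (subst summable_Suc_iff) auto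
    qed
  qed (use Bad_sets in \<open>auto simp: emeasure_eq_measure\<close>)
  then show ?thesis
  proof eventually_elim
    case (elim \<omega>)
    then obtain N where N: "\<And>n. n \<ge> N \<Longrightarrow> \<omega> \<in> space M - Bad (Suc n)" by (auto simp: eventually_sequentially)
    show ?case
    proof (intro exI[of _ "Suc N"] allI impI)
      fix T S :: nat and A B l m :: real
      assume TS: "T \<ge> 1" "S \<ge> 1" "T * S \<ge> Suc N"
        and bd: "\<bar>A\<bar> \<le> real R" "\<bar>B\<bar> \<le> real R" "\<bar>l\<bar> \<le> real R" "\<bar>m\<bar> \<le> real R"
      define n where "n = T * S"
      have n: "n > 0" "T \<le> n" "S \<le> n" using TS by (auto simp: n_def)
      have "\<omega> \<in> space M - Bad (Suc (n - 1))" using TS by (intro N) (auto simp: n_def)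
      then have notbad: "\<omega> \<in> space M - Bad n" using n by simp
      obtain \<theta> where \<theta>: "\<theta> \<in> net n"
        and close: "\<And>t s. t \<le> n \<Longrightarrow> s \<le> n \<Longrightarrow> \<bar>sinusoid (A, B, l, m) t s - sinusoid \<theta> t s\<bar> \<le> d"
        using net_close[OF n(1) bd] by blast
      let ?\<theta> = "(A, B, l, m)" and ?p = "(T, S)"
      have "?p \<in> box n" using TS n by (auto simp: box_def n_def)
      then have "\<omega> \<notin> bad ?p \<theta>" using notbad \<theta> by (auto simp: Bad_def)
      then have lower: "(\<Sum>i\<in>I ?p. shift_risk M (X i) (h \<theta> i)) - d * real (card (I ?p))
          \<le> (\<Sum>i\<in>I ?p. \<bar>X i \<omega> + h \<theta> i\<bar> - \<bar>X i \<omega>\<bar>)"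
        using notbad by (auto simp: bad_def)
      have h_close: "\<bar>h ?\<theta> i - h \<theta> i\<bar> \<le> d" if "i \<in> I ?p" for i
      proof (cases i)
        case (Pair t s)
        then show ?thesis using close[of t s] that n unfolding I_def h_def by auto
      qed
      have "(\<Sum>i\<in>I ?p. shift_risk M (X i) (h ?\<theta> i)) - \<kappa> * real (card (I ?p))
          = (\<Sum>i\<in>I ?p. shift_risk M (X i) (h ?\<theta> i) - d) - d * real (card (I ?p)) - d * real (card (I ?p))"
        by (simp add: sum_subtractf d_def algebra_simps)
      also have "\<dots> \<le> (\<Sum>i\<in>I ?p. shift_risk M (X i) (h \<theta> i)) - d * real (card (I ?p)) - d * real (card (I ?p))"
      proof (intro diff_right_mono sum_mono)
        fix i assume i: "i \<in> I ?p"
        have "X i \<in> borel_measurable M" using i I(2) by (intro X_rv) blast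
        from shift_risk_diff_le[OF this, of "h ?\<theta> i" "h \<theta> i"] h_close[OF i]
        show "shift_risk M (X i) (h ?\<theta> i) - d \<le> shift_risk M (X i) (h \<theta> i)" by linarith
      qed
      also have "\<dots> \<le> (\<Sum>i\<in>I ?p. \<bar>X i \<omega> + h \<theta> i\<bar> - \<bar>X i \<omega>\<bar>) - d * real (card (I ?p))"
        using lower by linarith
      also have "\<dots> = (\<Sum>i\<in>I ?p. \<bar>X i \<omega> + h \<theta> i\<bar> - \<bar>X i \<omega>\<bar> - d)"
        by (simp add: sum_subtractf)
      also have "\<dots> \<le> (\<Sum>i\<in>I ?p. \<bar>X i \<omega> + h ?\<theta> i\<bar> - \<bar>X i \<omega>\<bar>)"
      proof (rule sum_mono)
        fix i assume "i \<in> I ?p"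
        from h_close[OF this]
        show "\<bar>X i \<omega> + h \<theta> i\<bar> - \<bar>X i \<omega>\<bar> - d \<le> \<bar>X i \<omega> + h ?\<theta> i\<bar> - \<bar>X i \<omega>\<bar>" by linarith
      qed
      finally show "(\<Sum>t=1..T. \<Sum>s=1..S. shift_risk M (\<epsilon> t s) (sinusoid (A0, B0, l0, m0) t s - sinusoid ?\<theta> t s))
            - \<kappa> * (real T * real S)
          \<le> (\<Sum>t=1..T. \<Sum>s=1..S. \<bar>\<epsilon> t s \<omega> + (sinusoid (A0, B0, l0, m0) t s - sinusoid ?\<theta> t s)\<bar> - \<bar>\<epsilon> t s \<omega>\<bar>)"
        unfolding I(3) unfolding I_def X_def h_def by (simp add: sum.cartesian_product split_def del: sinusoid.simps)
    qed
  qed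
qed

section \<open>Strong consistency\<close>

theorem theorem3p2:
  fixes M :: "'w measure"
    and y \<epsilon> :: "nat \<Rightarrow> nat \<Rightarrow> 'w \<Rightarrow> real"
    and G g g' :: "real \<Rightarrow> real"
    and K :: "real set"
    and A0 B0 lam0 mu0 :: real
    and \<theta>hat :: "nat \<Rightarrow> nat \<Rightarrow> 'w \<Rightarrow> param"
  assumes prob: "prob_space M"
    and model: "\<And>t s \<omega>. t \<ge> 1 \<Longrightarrow> s \<ge> 1 \<Longrightarrow> \<omega> \<in> space M \<Longrightarrow>
          y t s \<omega> = sinusoid (A0, B0, lam0, mu0) t s + \<epsilon> t s \<omega>"
    and nondegenerate: "(A0, B0) \<noteq> (0, 0)"
    and K_compact: "compact K"
    and interior: "(A0, B0, lam0, mu0) \<in> interior (param_space K)"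
    and indep: "prob_space.indep_vars M (\<lambda>_. borel) (\<lambda>(t, s). \<epsilon> t s) ({1..} \<times> {1..})"
    and distribution: "\<And>t s. t \<ge> 1 \<Longrightarrow> s \<ge> 1 \<Longrightarrow> cdf (distr M borel (\<epsilon> t s)) = G"
    and density: "\<And>t s. t \<ge> 1 \<Longrightarrow> s \<ge> 1 \<Longrightarrow>
          distributed M lborel (\<epsilon> t s) (\<lambda>x. ennreal (g x))"
    and g_nonneg: "\<And>x. g x \<ge> 0"
    and g_continuous: "continuous_on UNIV g"
    and median: "G 0 = 1 / 2"
    and median_unique: "\<And>x. G x = 1 / 2 \<Longrightarrow> x = 0"
    and g_deriv: "\<And>x. (g has_real_derivative g' x) (at x)"
    and g'_bounded: "bounded (range g')"
    and second_moment: "\<And>t s. t \<ge> 1 \<Longrightarrow> s \<ge> 1 \<Longrightarrow> integrable M (\<lambda>\<omega>. (\<epsilon> t s \<omega>)\<^sup>2)"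
    and estimator: "\<And>T S \<omega>. T \<ge> 1 \<Longrightarrow> S \<ge> 1 \<Longrightarrow> \<omega> \<in> space M \<Longrightarrow>
          is_lad_estimate (param_space K) (\<lambda>t s. y t s \<omega>) T S (\<theta>hat T S \<omega>)"
  shows "AE \<omega> in M. ((\<lambda>(T, S). \<theta>hat T S \<omega>) \<longlongrightarrow> (A0, B0, lam0, mu0))
           (filtercomap (\<lambda>(T, S). min T S) sequentially)"
proof -
  interpret prob_space M by (rule prob)
  let ?\<theta>0 = "(A0, B0, lam0, mu0)"
  have \<theta>0: "?\<theta>0 \<in> param_space K" using interior interior_subset by blast
  have l0: "0 < lam0" "lam0 < pi" and m0: "0 < mu0" "mu0 < pi"
    using interior by (auto simp: param_space_def interior_Times interior_atLeastAtMost_real)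
  obtain b where b: "\<And>x. x \<in> K \<Longrightarrow> \<bar>x\<bar> \<le> b"
    using compact_imp_bounded[OF K_compact] by (auto simp: bounded_iff)
  \<comment> \<open>One natural number bounds the amplitudes through \<open>b\<close> and the
    frequencies through \<open>pi < 4\<close>, as the net uses a common range.\<close>
  obtain R :: nat where R: "max b 4 < real R" using reals_Archimedean2 by blast
  have R0: "R > 0" using R by (cases R) auto
  have box: "\<bar>A\<bar> \<le> real R" "\<bar>B\<bar> \<le> real R" "\<bar>l\<bar> \<le> real R" "\<bar>m\<bar> \<le> real R" "l \<in> {0..pi}" "m \<in> {0..pi}"
    if "(A, B, l, m) \<in> param_space K" for A B l m
  proof -
    have mem: "A \<in> K" "B \<in> K" "0 \<le> l" "l \<le> pi" "0 \<le> m" "m \<le> pi"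
      using that by (auto simp: param_space_def)
    then show "l \<in> {0..pi}" "m \<in> {0..pi}" by auto
    show "\<bar>A\<bar> \<le> real R" "\<bar>B\<bar> \<le> real R" "\<bar>l\<bar> \<le> real R" "\<bar>m\<bar> \<le> real R"
      using b[OF mem(1)] b[OF mem(2)] mem(3-6) R pi_less_4 by linarith+
  qed
  have rv: "\<epsilon> t s \<in> borel_measurable M" if "t \<ge> 1" "s \<ge> 1" for t s
    using density[OF that] by (simp add: distributed_def)
  \<comment> \<open>Equal distribution functions give equal laws, so all errors share one risk
    function and one constant \<open>c\<close>.\<close>
  have same: "shift_risk M (\<epsilon> t s) h = shift_risk M (\<epsilon> 1 1) h" if ts: "t \<ge> 1" "s \<ge> 1" for t s h
  proof (rule shift_risk_cong_distr)
    show "distr M borel (\<epsilon> t s) = distr M borel (\<epsilon> 1 1)"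
      using ts by (intro cdf_unique real_distribution_distr rv) (simp_all add: distribution)
  qed (use ts in \<open>auto intro!: rv\<close>)
  have "AE \<omega> in M. eventually (\<lambda>(T, S). dist (\<theta>hat T S \<omega>) ?\<theta>0 < e)
      (filtercomap (\<lambda>(T, S). min T S) sequentially)" if e: "e > 0" for e
  proof -
    obtain \<kappa> N where \<kappa>: "\<kappa> > 0" and sep: "\<And>T S A B l m. N \<le> T \<Longrightarrow> N \<le> S \<Longrightarrow> \<bar>A\<bar> \<le> real R \<Longrightarrow> \<bar>B\<bar> \<le> real R \<Longrightarrow>
       l \<in> {0..pi} \<Longrightarrow> m \<in> {0..pi} \<Longrightarrow> e \<le> dist (A, B, l, m) ?\<theta>0 \<Longrightarrow>
       \<kappa> * (real T * real S) \<le> (\<Sum>t=1..T. \<Sum>s=1..S. (sinusoid ?\<theta>0 t s - sinusoid (A, B, l, m) t s)\<^sup>2)"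
      by (rule sinusoid_separation[OF l0 m0 nondegenerate box(1,2)[OF \<theta>0] e]) blast
    define H where "H = 4 * real R"
    have H: "H > 0" using R0 by (simp add: H_def)
    have h_bd: "\<bar>sinusoid ?\<theta>0 t s - sinusoid (A, B, l, m) t s\<bar> \<le> H"
      if "\<bar>A\<bar> \<le> real R" "\<bar>B\<bar> \<le> real R" for A B l m t s
      using abs_sinusoid_le[OF box(1,2)[OF \<theta>0], of lam0 mu0 t s] abs_sinusoid_le[OF that, of l m t s]
      unfolding H_def by linarith
    \<comment> \<open>As \<open>\<bar>h\<bar> \<le> H\<close>, a mean square of at least
      \<open>\<kappa>\<close> forces a mean absolute value of at least
      \<open>\<kappa> / H = 2 * \<eta>\<close>. The mean risk is then at least
      \<open>c * \<eta> = 2 * r\<close>, and a random deviation of \<open>r\<close> leaves a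
      positive excess.\<close>
    define \<eta> where "\<eta> = \<kappa> / (2 * H)"
    have \<eta>: "\<eta> > 0" using \<kappa> H by (simp add: \<eta>_def)
    obtain c where c: "c > 0" and lin: "\<And>h. c * (\<bar>h\<bar> - \<eta>) \<le> shift_risk M (\<epsilon> 1 1) h"
      using shift_risk_ge_linear[OF rv[of 1 1] _ _ \<eta>] median median_unique distribution[of 1 1] by auto
    define r where "r = c * \<eta> / 2"
    have r: "r > 0" using c \<eta> by (simp add: r_def)
    have risk: "2 * r * (real T * real S) \<le>
        (\<Sum>t=1..T. \<Sum>s=1..S. shift_risk M (\<epsilon> t s) (sinusoid ?\<theta>0 t s - sinusoid (A, B, l, m) t s))"
      if far: "N \<le> T" "N \<le> S" "\<bar>A\<bar> \<le> real R" "\<bar>B\<bar> \<le> real R" "l \<in> {0..pi}" "m \<in> {0..pi}"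
        "e \<le> dist (A, B, l, m) ?\<theta>0" for T S A B l m
    proof -
      let ?h = "\<lambda>t s. sinusoid ?\<theta>0 t s - sinusoid (A, B, l, m) t s"
      have "2 * r * (real T * real S) = c / H * (\<kappa> * (real T * real S)) - c * \<eta> * (real T * real S)"
        using H by (simp add: r_def \<eta>_def field_simps)
      also have "\<dots> \<le> c / H * (\<Sum>t=1..T. \<Sum>s=1..S. (?h t s)\<^sup>2) - c * \<eta> * (real T * real S)"
        using sep[OF far] c H by (intro diff_right_mono mult_left_mono) auto
      also have "\<dots> = (\<Sum>t=1..T. \<Sum>s=1..S. c / H * (?h t s)\<^sup>2 - c * \<eta>)"
        by (simp add: sum_subtractf sum_distrib_left del: sinusoid.simps)
      also have "\<dots> \<le> (\<Sum>t=1..T. \<Sum>s=1..S. shift_risk M (\<epsilon> t s) (?h t s))"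
      proof (intro sum_mono)
        fix t s assume ts: "t \<in> {1..T}" "s \<in> {1..S}"
        define u where "u = ?h t s"
        have "\<bar>u\<bar> \<le> H" unfolding u_def by (rule h_bd[OF far(3,4)])
        then have "u\<^sup>2 \<le> H * \<bar>u\<bar>"
          using mult_right_mono[of "\<bar>u\<bar>" H "\<bar>u\<bar>"] by (simp add: power2_eq_square)
        then have "c / H * u\<^sup>2 \<le> c / H * (H * \<bar>u\<bar>)" using c H by (intro mult_left_mono) auto
        also have "\<dots> = c * (\<bar>u\<bar> - \<eta>) + c * \<eta>" using H by (simp add: right_diff_distrib)
        also have "c * (\<bar>u\<bar> - \<eta>) \<le> shift_risk M (\<epsilon> t s) u" using lin[of u] same[of t s u] ts by simp
        finally show "c / H * (?h t s)\<^sup>2 - c * \<eta> \<le> shift_risk M (\<epsilon> t s) (?h t s)"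
          unfolding u_def by linarith
      qed
      finally show ?thesis .
    qed
    \<comment> \<open>The model equation and the minimizing property are assumed only for points of
      the sample space.\<close>
    have "AE \<omega> in M. \<omega> \<in> space M" by simp
    with AE_uniform_abs_shift_lower_bound[OF indep R0 box(1,2)[OF \<theta>0] r, of lam0 mu0]
    show ?thesis
    proof eventually_elim
      case (elim \<omega>)
      then obtain N' where N': "\<And>T S A B l m. T \<ge> 1 \<Longrightarrow> S \<ge> 1 \<Longrightarrow> T * S \<ge> N' \<Longrightarrow>
          \<bar>A\<bar> \<le> real R \<Longrightarrow> \<bar>B\<bar> \<le> real R \<Longrightarrow> \<bar>l\<bar> \<le> real R \<Longrightarrow> \<bar>m\<bar> \<le> real R \<Longrightarrow>
          (\<Sum>t=1..T. \<Sum>s=1..S. shift_risk M (\<epsilon> t s) (sinusoid ?\<theta>0 t s - sinusoid (A, B, l, m) t s))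
            - r * (real T * real S)
          \<le> (\<Sum>t=1..T. \<Sum>s=1..S. \<bar>\<epsilon> t s \<omega> + (sinusoid ?\<theta>0 t s - sinusoid (A, B, l, m) t s)\<bar> - \<bar>\<epsilon> t s \<omega>\<bar>)"
        by blast
      have "dist (\<theta>hat T S \<omega>) ?\<theta>0 < e" if TS: "T \<ge> Suc (N + N')" "S \<ge> Suc (N + N')" for T S
      \<comment> \<open>A minimizer has nonpositive excess over the true parameter, while at
        distance \<open>e\<close> or more the excess is at least \<open>r * (T * S) > 0\<close>.
        Only this comparison is used, so any choice among several minimizers is covered.\<close>
      proof (rule ccontr)
        assume far: "\<not> dist (\<theta>hat T S \<omega>) ?\<theta>0 < e"
        obtain A B l m where \<theta>: "\<theta>hat T S \<omega> = (A, B, l, m)" by (cases "\<theta>hat T S \<omega>")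
        have TS1: "T \<ge> 1" "S \<ge> 1" "N \<le> T" "N \<le> S" using TS by auto
        have "N' * 1 \<le> T * S" using TS by (intro mult_le_mono) auto
        then have TSN': "T * S \<ge> N'" by simp
        have pos: "real T * real S > 0" using TS1 by simp
        have est: "is_lad_estimate (param_space K) (\<lambda>t s. y t s \<omega>) T S (A, B, l, m)"
          using estimator[OF TS1(1,2) elim(2)] \<theta> by simp
        then have mem: "(A, B, l, m) \<in> param_space K"
          by (simp add: is_lad_estimate_def is_arg_min_def)
        from est \<theta>0 have "lad_objective (\<lambda>t s. y t s \<omega>) T S (A, B, l, m) \<le> lad_objective (\<lambda>t s. y t s \<omega>) T S ?\<theta>0"
          by (auto simp: is_lad_estimate_def is_arg_min_def not_less)
        then have "(\<Sum>t=1..T. \<Sum>s=1..S. \<bar>y t s \<omega> - sinusoid (A, B, l, m) t s\<bar>)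
            \<le> (\<Sum>t=1..T. \<Sum>s=1..S. \<bar>y t s \<omega> - sinusoid ?\<theta>0 t s\<bar>)"
          using pos by (simp add: lad_objective_def divide_le_cancel del: sinusoid.simps)
        also have "\<dots> = (\<Sum>t=1..T. \<Sum>s=1..S. \<bar>\<epsilon> t s \<omega>\<bar>)"
          by (intro sum.cong refl) (simp add: model elim(2) del: sinusoid.simps)
        also have "(\<Sum>t=1..T. \<Sum>s=1..S. \<bar>y t s \<omega> - sinusoid (A, B, l, m) t s\<bar>)
          = (\<Sum>t=1..T. \<Sum>s=1..S. \<bar>\<epsilon> t s \<omega> + (sinusoid ?\<theta>0 t s - sinusoid (A, B, l, m) t s)\<bar>)"
          by (intro sum.cong refl) (simp add: model elim(2) algebra_simps del: sinusoid.simps)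
        finally have "(\<Sum>t=1..T. \<Sum>s=1..S. \<bar>\<epsilon> t s \<omega> + (sinusoid ?\<theta>0 t s - sinusoid (A, B, l, m) t s)\<bar> - \<bar>\<epsilon> t s \<omega>\<bar>) \<le> 0"
          by (simp add: sum_subtractf del: sinusoid.simps)
        moreover have "2 * r * (real T * real S) \<le>
            (\<Sum>t=1..T. \<Sum>s=1..S. shift_risk M (\<epsilon> t s) (sinusoid ?\<theta>0 t s - sinusoid (A, B, l, m) t s))"
          using far box[OF mem] TS1 by (intro risk) (auto simp: \<theta>)
        moreover note N'[OF TS1(1,2) TSN' box(1-4)[OF mem]]
        moreover have "r * (real T * real S) > 0" using r pos by (rule mult_pos_pos)
        ultimately show False by linarith
      qed
      then show ?case
        unfolding eventually_filtercomap eventually_sequentially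
        by (intro exI[of _ "\<lambda>n. n \<ge> Suc (N + N')"]) auto
    qed
  qed
  \<comment> \<open>The null set depends on the radius; countably many radii tending to zero yield a
    common one.\<close>
  then have "AE \<omega> in M. \<forall>j. eventually (\<lambda>(T, S). dist (\<theta>hat T S \<omega>) ?\<theta>0 < inverse (real (Suc j)))
      (filtercomap (\<lambda>(T, S). min T S) sequentially)"
    unfolding AE_all_countable by simp
  then show ?thesis
  proof eventually_elim
    case (elim \<omega>)
    show ?case
    proof (rule tendstoI)
      fix e :: real assume "e > 0"
      then obtain j where j: "inverse (real (Suc j)) < e" using reals_Archimedean by blast
      from elim[rule_format, of j]
      show "eventually (\<lambda>x. dist (case x of (T, S) \<Rightarrow> \<theta>hat T S \<omega>) ?\<theta>0 < e)
          (filtercomap (\<lambda>(T, S). min T S) sequentially)"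
        by (rule eventually_mono) (use j in \<open>auto simp del: of_nat_Suc\<close>)
    qed
  qed
qed

end
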